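(* Let $\mathcal H$ be a real Hilbert space, let $\mu\in\,]0,\infty[$, let $n\ge 1$ be an integer, $I=\{1,\dots,n\}$, and let $\lambda_i>0$ ($i\in I$) satisfy $\sum_{i\in I}\lambda_i=1$. For each $i\in I$ let $A_i:\mathcal H\rightrightarrows\mathcal H$ be maximally monotone, and write $\mathbf A=(A_1,\dots,A_n)$, $\boldsymbol\lambda=(\lambda_1,\dots,\lambda_n)$. Let $x,u\in\mathcal H$. If $\bigcap_{i\in I}A_i(x)\neq\varnothing$, then $$\mathcal R_\mu(\mathbf A,\boldsymbol\lambda)(x)=\bigcap_{i\in I}A_i(x).$$ If $\bigcap_{i\in I}A_i^{-1}(u)\neq\varnothing$, then $$\mathcal R_\mu(\mathbf A,\boldsymbol\lambda)^{-1}(u)=\bigcap_{i\in I}A_i^{-1}(u).$$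
   Context: For a set-valued mapping $A:\mathcal H\rightrightarrows\mathcal H$ the inverse $A^{-1}$ is the set-valued mapping defined by $x\in A^{-1}u\Leftrightarrow u\in Ax$. Sums and scalar multiples of set-valued mappings are pointwise Minkowski operations; $\mathrm{Id}$ is the identity. The $\boldsymbol\lambda$-weighted resolvent average of $\mathbf A$ with parameter $\mu$ is the set-valued mapping $$\mathcal R_\mu(\mathbf A,\boldsymbol\lambda)=\Big(\sum_{i\in I}\lambda_i(A_i+\mu^{-1}\mathrm{Id})^{-1}\Big)^{-1}-\mu^{-1}\mathrm{Id}.$$ *)

theory Defs
  imports "HOL-Analysis.Analysis" "HOL-Library.Set_Algebras"
begin

text \<open>
  A set-valued mapping from a space to itself is a function of type \<open>'a \<Rightarrow> 'a set\<close>; an empty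
  value means that the point is outside the domain.  On sets, \<open>+\<close> and finite sums are the
  Minkowski operations of Set_Algebras, whereas \<open>-\<close> is set difference, so the Minkowski
  difference is spelled out in \<open>svm_diff\<close>.
\<close>

type_synonym 'a svm = "'a \<Rightarrow> 'a set"

definition svm_id :: "'a svm" where
  "svm_id = (\<lambda>x. {x})"

definition svm_inverse :: "'a svm \<Rightarrow> 'a svm" where
  "svm_inverse A = (\<lambda>u. {x. u \<in> A x})"

definition svm_scale :: "real \<Rightarrow> 'a::real_vector svm \<Rightarrow> 'a svm" where
  "svm_scale c A = (\<lambda>x. (\<lambda>u. c *\<^sub>R u) ` A x)"

definition svm_add :: "'a::real_vector svm \<Rightarrow> 'a svm \<Rightarrow> 'a svm" where
  "svm_add A B = (\<lambda>x. A x + B x)"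

definition svm_diff :: "'a::real_vector svm \<Rightarrow> 'a svm \<Rightarrow> 'a svm" where
  "svm_diff A B = (\<lambda>x. {u - v | u v. u \<in> A x \<and> v \<in> B x})"

definition svm_sum :: "('i \<Rightarrow> 'a::real_vector svm) \<Rightarrow> 'i set \<Rightarrow> 'a svm" where
  "svm_sum A I = (\<lambda>x. \<Sum>i\<in>I. A i x)"

definition monotone_svm :: "'a::real_inner svm \<Rightarrow> bool" where
  "monotone_svm A \<longleftrightarrow>
    (\<forall>x y u v. u \<in> A x \<longrightarrow> v \<in> A y \<longrightarrow> inner (x - y) (u - v) \<ge> 0)"

text \<open>Maximality is with respect to inclusion of graphs, i.e. pointwise inclusion of values.\<close>

definition maximally_monotone :: "'a::real_inner svm \<Rightarrow> bool" where
  "maximally_monotone A \<longleftrightarrow>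
    monotone_svm A \<and> (\<forall>B. monotone_svm B \<and> (\<forall>x. A x \<subseteq> B x) \<longrightarrow> B = A)"

definition resolvent_average ::
    "real \<Rightarrow> 'i set \<Rightarrow> ('i \<Rightarrow> 'a::real_vector svm) \<Rightarrow> ('i \<Rightarrow> real) \<Rightarrow> 'a svm" where
  "resolvent_average \<mu> I A w =
    svm_diff
      (svm_inverse
        (svm_sum
          (\<lambda>i. svm_scale (w i) (svm_inverse (svm_add (A i) (svm_scale (inverse \<mu>) svm_id)))) I))
      (svm_scale (inverse \<mu>) svm_id)"

end

theory Submission
  imports Defs
begin

text \<open>
  Unfolding the definitions, \<open>u\<close> lies in the resolvent average at \<open>x\<close> exactly when \<open>x\<close> is a
  weighted mean of points \<open>y i\<close> with \<open>u + (x - y i) / \<mu> \<in> A i (y i)\<close>.  Taking \<open>y i = x\<close> shows that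
  common values of the \<open>A i\<close> always belong to the average.  Conversely, let \<open>v\<close> be a common value
  of the \<open>A i\<close> at some \<open>p\<close>.  Monotonicity of \<open>A i\<close> between \<open>(y i, u + (x - y i) / \<mu>)\<close> and
  \<open>(p, v)\<close>, averaged with the weights, gives
  \<open>(\<Sum>i. w i * (norm (x - y i))\<^sup>2) / \<mu> \<le> inner (x - p) (u - v)\<close>,
  the mixed terms vanishing because the weighted mean of the \<open>x - y i\<close> is zero.  If \<open>p = x\<close> or
  \<open>v = u\<close>, the right-hand side is zero, so every \<open>y i\<close> equals \<open>x\<close> and \<open>u\<close> is a common value at
  \<open>x\<close>.  The two choices yield the two identities.
\<close>

text \<open>
  A point \<open>y\<close> lies in the image of \<open>u + x / \<mu>\<close> under the inverse of \<open>A i + Id / \<mu>\<close> exactly when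
  \<open>u + (x - y) / \<mu>\<close> lies in \<open>A i y\<close>; a Minkowski sum of such images is a choice of one \<open>y i\<close>
  for each \<open>i\<close>.
\<close>

lemma mem_resolvent_average_iff:
  fixes A :: "'i \<Rightarrow> 'a::real_vector svm"
  assumes "finite I"
  shows "u \<in> resolvent_average \<mu> I A w x \<longleftrightarrow>
    (\<exists>y. x = (\<Sum>i\<in>I. w i *\<^sub>R y i) \<and> (\<forall>i\<in>I. u + inverse \<mu> *\<^sub>R (x - y i) \<in> A i (y i)))"
    (is "_ \<longleftrightarrow> ?R")
proof -
  define S where "S i = svm_scale (w i)
      (svm_inverse (svm_add (A i) (svm_scale (inverse \<mu>) svm_id))) (u + inverse \<mu> *\<^sub>R x)" for i
  have S: "s \<in> S i \<longleftrightarrow> (\<exists>y. s = w i *\<^sub>R y \<and> u + inverse \<mu> *\<^sub>R (x - y) \<in> A i y)" for s i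
  proof -
    have shift: "(\<exists>a\<in>A i y. u + inverse \<mu> *\<^sub>R x = a + inverse \<mu> *\<^sub>R y) \<longleftrightarrow>
        u + inverse \<mu> *\<^sub>R (x - y) \<in> A i y" for y
    proof -
      have "u + inverse \<mu> *\<^sub>R x = a + inverse \<mu> *\<^sub>R y \<longleftrightarrow> a = u + inverse \<mu> *\<^sub>R (x - y)" for a
        by (auto simp: scaleR_diff_right algebra_simps)
      then show ?thesis by simp
    qed
    show ?thesis
      by (auto simp: S_def svm_scale_def svm_inverse_def svm_add_def svm_id_def set_plus_def
          image_iff shift)
  qed
  have "u \<in> resolvent_average \<mu> I A w x \<longleftrightarrow> x \<in> (\<Sum>i\<in>I. S i)"
    by (force simp: resolvent_average_def svm_diff_def svm_scale_def svm_id_def svm_sum_def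
        svm_inverse_def S_def)
  also have "\<dots> \<longleftrightarrow> (\<exists>s. x = sum s I \<and> (\<forall>i\<in>I. s i \<in> S i))"
    by (simp add: set_sum_alt[OF assms])
  also have "\<dots> \<longleftrightarrow> ?R"
  proof
    assume "\<exists>s. x = sum s I \<and> (\<forall>i\<in>I. s i \<in> S i)"
    then obtain s where s: "x = sum s I" "\<forall>i\<in>I. s i \<in> S i"
      by blast
    then have "\<forall>i\<in>I. \<exists>y. s i = w i *\<^sub>R y \<and> u + inverse \<mu> *\<^sub>R (x - y) \<in> A i y"
      by (simp add: S)
    then obtain y where y: "\<forall>i\<in>I. s i = w i *\<^sub>R y i \<and> u + inverse \<mu> *\<^sub>R (x - y i) \<in> A i (y i)"
      by (metis bchoice)
    moreover from this s(1) have "x = (\<Sum>i\<in>I. w i *\<^sub>R y i)"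
      by (metis (mono_tags, lifting) sum.cong)
    ultimately show ?R
      by blast
  next
    assume ?R
    then obtain y where "x = (\<Sum>i\<in>I. w i *\<^sub>R y i)"
        "\<forall>i\<in>I. u + inverse \<mu> *\<^sub>R (x - y i) \<in> A i (y i)"
      by blast
    then show "\<exists>s. x = sum s I \<and> (\<forall>i\<in>I. s i \<in> S i)"
      by (intro exI[of _ "\<lambda>i. w i *\<^sub>R y i"]) (auto simp: S)
  qed
  finally show ?thesis .
qed

lemma Inter_subset_resolvent_average:
  fixes A :: "'i \<Rightarrow> 'a::real_vector svm"
  assumes "finite I" and "(\<Sum>i\<in>I. w i) = 1"
  shows "(\<Inter>i\<in>I. A i x) \<subseteq> resolvent_average \<mu> I A w x"
proof
  fix u assume "u \<in> (\<Inter>i\<in>I. A i x)"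
  moreover have "x = (\<Sum>i\<in>I. w i *\<^sub>R x)"
    using assms(2) by (simp flip: scaleR_left.sum)
  ultimately show "u \<in> resolvent_average \<mu> I A w x"
    unfolding mem_resolvent_average_iff[OF assms(1)] by (intro exI[of _ "\<lambda>_. x"]) auto
qed

text \<open>
  The sign condition on \<open>inner (x - p) (u - v)\<close> covers both uses at once: a common value at the
  same point (\<open>p = x\<close>) and the same common value at another point (\<open>v = u\<close>).
\<close>

lemma resolvent_average_mem_Inter:
  fixes A :: "'i \<Rightarrow> 'a::real_inner svm"
  assumes fin: "finite I" and mu: "\<mu> > 0"
    and pos: "\<And>i. i \<in> I \<Longrightarrow> w i > 0" and sum1: "(\<Sum>i\<in>I. w i) = 1"
    and mono: "\<And>i. i \<in> I \<Longrightarrow> monotone_svm (A i)"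
    and v: "v \<in> (\<Inter>i\<in>I. A i p)" and le: "inner (x - p) (u - v) \<le> 0"
    and u: "u \<in> resolvent_average \<mu> I A w x"
  shows "u \<in> (\<Inter>i\<in>I. A i x)"
proof -
  obtain y where x: "x = (\<Sum>i\<in>I. w i *\<^sub>R y i)"
    and y: "\<And>i. i \<in> I \<Longrightarrow> u + inverse \<mu> *\<^sub>R (x - y i) \<in> A i (y i)"
    using u unfolding mem_resolvent_average_iff[OF fin] by blast
  have mean: "(\<Sum>i\<in>I. w i *\<^sub>R (x - y i)) = 0"
    using x sum1 by (simp add: scaleR_diff_right sum_subtractf flip: scaleR_left.sum)
  \<comment> \<open>The only part of the expansion that is linear in \<open>x - y i\<close> is its inner product with a vector
    \<open>c\<close> independent of \<open>i\<close>, so it vanishes after averaging.\<close>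
  define c where "c = inverse \<mu> *\<^sub>R (x - p) - (u - v)"
  have expand: "inner (y i - p) (u + inverse \<mu> *\<^sub>R (x - y i) - v) =
      inner (x - p) (u - v) + inner (x - y i) c - inverse \<mu> * inner (x - y i) (x - y i)" for i
    by (simp add: c_def inner_diff_left inner_diff_right inner_add_left inner_add_right
        inner_commute algebra_simps)
  have "0 \<le> (\<Sum>i\<in>I. w i * inner (y i - p) (u + inverse \<mu> *\<^sub>R (x - y i) - v))"
  proof (intro sum_nonneg mult_nonneg_nonneg)
    fix i assume i: "i \<in> I"
    show "0 \<le> w i" using pos[OF i] by simp
    show "0 \<le> inner (y i - p) (u + inverse \<mu> *\<^sub>R (x - y i) - v)"
      using mono[OF i] y[OF i] v i unfolding monotone_svm_def by blast
  qed
  also have "\<dots> = (\<Sum>i\<in>I. w i) * inner (x - p) (u - v) + inner (\<Sum>i\<in>I. w i *\<^sub>R (x - y i)) c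
      - inverse \<mu> * (\<Sum>i\<in>I. w i * inner (x - y i) (x - y i))"
    unfolding expand
    by (simp add: inner_sum_left sum_distrib_left sum_distrib_right sum.distrib sum_subtractf
        distrib_left right_diff_distrib mult.left_commute)
  finally have "inverse \<mu> * (\<Sum>i\<in>I. w i * inner (x - y i) (x - y i)) \<le> 0"
    using le by (simp add: sum1 mean)
  then have "(\<Sum>i\<in>I. w i * inner (x - y i) (x - y i)) \<le> 0"
    using mu by (simp add: mult_le_0_iff)
  moreover have nonneg: "0 \<le> w i * inner (x - y i) (x - y i)" if "i \<in> I" for i
    using pos[OF that] by simp
  ultimately have "(\<Sum>i\<in>I. w i * inner (x - y i) (x - y i)) = 0"
    by (meson order_antisym sum_nonneg)
  then have "w i * inner (x - y i) (x - y i) = 0" if "i \<in> I" for i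
    using sum_nonneg_eq_0_iff[OF fin, of "\<lambda>i. w i * inner (x - y i) (x - y i)"] nonneg that
    by blast
  then have "y i = x" if "i \<in> I" for i
    using pos[OF that] that by fastforce
  then show ?thesis
    using y by fastforce
qed

theorem theorem2p5:
  fixes \<mu> :: real and n :: nat and w :: "nat \<Rightarrow> real"
    and A :: "nat \<Rightarrow> 'a::{real_inner, complete_space} \<Rightarrow> 'a set"
    and x u :: 'a
  assumes "\<mu> > 0" and "n \<ge> 1"
    and "\<And>i. i \<in> {1..n} \<Longrightarrow> w i > 0"
    and "(\<Sum>i\<in>{1..n}. w i) = 1"
    and "\<And>i. i \<in> {1..n} \<Longrightarrow> maximally_monotone (A i)"
  shows "((\<Inter>i\<in>{1..n}. A i x) \<noteq> {} \<longrightarrow>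
            resolvent_average \<mu> {1..n} A w x = (\<Inter>i\<in>{1..n}. A i x)) \<and>
         ((\<Inter>i\<in>{1..n}. svm_inverse (A i) u) \<noteq> {} \<longrightarrow>
            svm_inverse (resolvent_average \<mu> {1..n} A w) u = (\<Inter>i\<in>{1..n}. svm_inverse (A i) u))"
proof -
  have mono: "monotone_svm (A i)" if "i \<in> {1..n}" for i
    using assms(5)[OF that] by (simp add: maximally_monotone_def)
  note sub = Inter_subset_resolvent_average[OF finite_atLeastAtMost assms(4), where A = A and \<mu> = \<mu>]
  note sup = resolvent_average_mem_Inter[OF finite_atLeastAtMost assms(1,3,4) mono]
  have inverse_Inter: "z \<in> (\<Inter>i\<in>{1..n}. svm_inverse (A i) u) \<longleftrightarrow> u \<in> (\<Inter>i\<in>{1..n}. A i z)" for z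
    by (simp add: svm_inverse_def)
  show ?thesis
  proof (intro conjI impI)
    assume "(\<Inter>i\<in>{1..n}. A i x) \<noteq> {}"
    then obtain v where "v \<in> (\<Inter>i\<in>{1..n}. A i x)"
      by blast
    from sup[OF _ _ this]
    have "resolvent_average \<mu> {1..n} A w x \<subseteq> (\<Inter>i\<in>{1..n}. A i x)"
      by (intro subsetI) simp
    with sub show "resolvent_average \<mu> {1..n} A w x = (\<Inter>i\<in>{1..n}. A i x)"
      by blast
  next
    assume "(\<Inter>i\<in>{1..n}. svm_inverse (A i) u) \<noteq> {}"
    then obtain p where "u \<in> (\<Inter>i\<in>{1..n}. A i p)"
      using inverse_Inter by blast
    from sup[OF _ _ this, where u = u]
    have "u \<in> (\<Inter>i\<in>{1..n}. A i z)" if "u \<in> resolvent_average \<mu> {1..n} A w z" for z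
      using that by simp
    with sub have "u \<in> resolvent_average \<mu> {1..n} A w z \<longleftrightarrow> u \<in> (\<Inter>i\<in>{1..n}. A i z)" for z
      by blast
    then show "svm_inverse (resolvent_average \<mu> {1..n} A w) u = (\<Inter>i\<in>{1..n}. svm_inverse (A i) u)"
      unfolding set_eq_iff inverse_Inter by (simp add: svm_inverse_def)
  qed
qed

end
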